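(* Every $5\times 5$ non-consecutive Latin square is also an anti-knight Latin square.
   Context: A Latin square of order $n$ is an $n\times n$ table filled with the integers $1,\dots,n$ so that each integer appears exactly once in each row and in each column. A non-consecutive Latin square is a Latin square in which no two orthogonally adjacent cells contain integers differing by exactly $1$. An anti-knight Latin square is a Latin square in which any two cells separated by a chess knight's move (row and column indices differing by $1$ and $2$ in absolute value, in some order) contain different numbers. *)

theory Defs
  imports Main
begin

text \<open>
  A table of order \<open>n\<close> is a function \<open>L\<close> of the row and the column index; only its values on
  \<open>{1..n} \<times> {1..n}\<close> matter. Indices and entries are integers, so that differences do not truncate.
\<close>

definition latin_square :: "nat \<Rightarrow> (int \<Rightarrow> int \<Rightarrow> int) \<Rightarrow> bool" where
  "latin_square n L \<longleftrightarrow>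
     (\<forall>i\<in>{1..int n}. \<forall>j\<in>{1..int n}. L i j \<in> {1..int n}) \<and>
     (\<forall>i\<in>{1..int n}. \<forall>k\<in>{1..int n}. \<exists>!j. j \<in> {1..int n} \<and> L i j = k) \<and>
     (\<forall>j\<in>{1..int n}. \<forall>k\<in>{1..int n}. \<exists>!i. i \<in> {1..int n} \<and> L i j = k)"

definition orthogonally_adjacent :: "int \<times> int \<Rightarrow> int \<times> int \<Rightarrow> bool" where
  "orthogonally_adjacent = (\<lambda>(i, j) (i', j').
     (\<bar>i - i'\<bar> = 1 \<and> j = j') \<or> (i = i' \<and> \<bar>j - j'\<bar> = 1))"

definition knight_move :: "int \<times> int \<Rightarrow> int \<times> int \<Rightarrow> bool" where
  "knight_move = (\<lambda>(i, j) (i', j').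
     (\<bar>i - i'\<bar> = 1 \<and> \<bar>j - j'\<bar> = 2) \<or> (\<bar>i - i'\<bar> = 2 \<and> \<bar>j - j'\<bar> = 1))"

definition non_consecutive_latin_square :: "nat \<Rightarrow> (int \<Rightarrow> int \<Rightarrow> int) \<Rightarrow> bool" where
  "non_consecutive_latin_square n L \<longleftrightarrow>
     latin_square n L \<and>
     (\<forall>i\<in>{1..int n}. \<forall>j\<in>{1..int n}. \<forall>i'\<in>{1..int n}. \<forall>j'\<in>{1..int n}.
        orthogonally_adjacent (i, j) (i', j') \<longrightarrow> \<bar>L i j - L i' j'\<bar> \<noteq> 1)"

definition anti_knight_latin_square :: "nat \<Rightarrow> (int \<Rightarrow> int \<Rightarrow> int) \<Rightarrow> bool" where
  "anti_knight_latin_square n L \<longleftrightarrow>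
     latin_square n L \<and>
     (\<forall>i\<in>{1..int n}. \<forall>j\<in>{1..int n}. \<forall>i'\<in>{1..int n}. \<forall>j'\<in>{1..int n}.
        knight_move (i, j) (i', j') \<longrightarrow> L i j \<noteq> L i' j')"

end

theory Submission
  imports Defs
begin

text \<open>
  There are only 14 non-consecutive arrangements of \<open>1, \<dots>, 5\<close>, and enumerating triples of them shows
  that three successive rows of a non-consecutive Latin square never contain two equal entries a
  knight's move apart. Two such rows alone would not suffice: \<open>1 3 5 2 4\<close> and \<open>3 5 1 4 2\<close> are
  compatible neighbours with a conflict, but no third row fits next to them.
\<close>

definition apart :: "int \<Rightarrow> int \<Rightarrow> bool" where
  "apart x y \<longleftrightarrow> 1 < \<bar>x - y\<bar>"

text \<open>\<open>R\<close> constrains neighbours and \<open>S\<close> all pairs. The element type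
  is left open because the function serves twice: for entries within a row and for rows within a
  triple. Filtering after every extension keeps the enumeration small enough to evaluate.\<close>

primrec arrangements ::
  "('a \<Rightarrow> 'a \<Rightarrow> bool) \<Rightarrow> ('a \<Rightarrow> 'a \<Rightarrow> bool) \<Rightarrow> 'a list \<Rightarrow> nat \<Rightarrow> 'a list list" where
  "arrangements R S xs 0 = [[]]"
| "arrangements R S xs (Suc n) =
     filter (\<lambda>ys. successively R ys \<and> sorted_wrt S ys)
       (concat (map (\<lambda>ys. map (\<lambda>x. x # ys) xs) (arrangements R S xs n)))"

text \<open>Both conditions pass from a list to its tail, so pruning partial lists loses no full
  one.\<close>

lemma arrangements_complete:
  assumes "successively R ys" "sorted_wrt S ys" "set ys \<subseteq> set xs"
  shows "ys \<in> set (arrangements R S xs (length ys))"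
  using assms by (induction ys) (auto simp: successively_Cons)

definition non_consecutive_rows :: "int list list" where
  "non_consecutive_rows = arrangements apart (\<noteq>) [1..5] 5"

text \<open>Shifts in both directions are covered, and \<open>zip\<close> cuts off the overhang.
  Knight's moves need \<open>d = 2\<close> for neighbouring rows and \<open>d = 1\<close> for rows
  two apart.\<close>

definition unequal_at_distance :: "nat \<Rightarrow> 'a list \<Rightarrow> 'a list \<Rightarrow> bool" where
  "unequal_at_distance d r s \<longleftrightarrow>
     (\<forall>(x, y)\<in>set (zip (drop d r) s). x \<noteq> y) \<and> (\<forall>(x, y)\<in>set (zip r (drop d s)). x \<noteq> y)"

lemma three_rows_unequal:
  assumes "r \<in> set non_consecutive_rows" "s \<in> set non_consecutive_rows"
    "t \<in> set non_consecutive_rows"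
    and "list_all2 apart r s" "list_all2 apart s t" "list_all2 (\<noteq>) r t"
  shows "unequal_at_distance 2 r s" "unequal_at_distance 2 s t" "unequal_at_distance 1 r t"
proof -
  have "\<forall>rs\<in>set (arrangements (list_all2 apart) (list_all2 (\<noteq>)) non_consecutive_rows 3).
      unequal_at_distance 2 (rs ! 0) (rs ! 1) \<and> unequal_at_distance 2 (rs ! 1) (rs ! 2) \<and>
      unequal_at_distance 1 (rs ! 0) (rs ! 2)"
    by code_simp
  moreover have "[r, s, t] \<in> set (arrangements (list_all2 apart) (list_all2 (\<noteq>)) non_consecutive_rows 3)"
  proof -
    \<comment> \<open>Distinctness within columns is demanded of all three pairs of rows; for the
      two neighbouring pairs it follows from \<open>apart\<close>.\<close>
    have "list_all2 (\<noteq>) x y" if "list_all2 apart x y" for x y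
      using that by (rule list_all2_mono) (auto simp: apart_def)
    with assms have "sorted_wrt (list_all2 (\<noteq>)) [r, s, t]"
      by simp
    moreover have "successively (list_all2 apart) [r, s, t]" "set [r, s, t] \<subseteq> set non_consecutive_rows"
      using assms by simp_all
    moreover have "length [r, s, t] = 3"
      by simp
    ultimately show ?thesis
      by (metis arrangements_complete)
  qed
  ultimately show "unequal_at_distance 2 r s" "unequal_at_distance 2 s t" "unequal_at_distance 1 r t"
    by (auto dest!: bspec simp del: arrangements.simps)
qed

lemma unequal_at_distance_sym: "unequal_at_distance d r s \<longleftrightarrow> unequal_at_distance d s r"
  unfolding unequal_at_distance_def
  by (subst (1 2) zip_commute) auto

lemma unequal_at_distanceD:
  assumes "unequal_at_distance d r s" "n + d < length r" "n < length s"
  shows "r ! (n + d) \<noteq> s ! n"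
proof -
  have "(r ! (n + d), s ! n) \<in> set (zip (drop d r) s)"
    using assms(2,3) by (force simp: in_set_zip add.commute)
  with assms(1) show ?thesis
    by (auto simp: unequal_at_distance_def)
qed

definition row :: "(int \<Rightarrow> int \<Rightarrow> int) \<Rightarrow> int \<Rightarrow> int list" where
  "row L i = map (L i) [1..5]"

lemma upto_1_5: "[1..5] = [1, 2, 3, 4, 5::int]"
  by code_simp

lemma row_nth: "j \<in> {1..5} \<Longrightarrow> row L i ! nat (j - 1) = L i j"
  by (subst row_def, subst nth_map) (auto simp: nth_upto)

lemma length_row: "length (row L i) = 5"
  by (simp add: row_def)

lemma unequal_at_distance_rowD:
  assumes "unequal_at_distance d (row L i) (row L i')" "\<bar>j - k\<bar> = int d" "j \<in> {1..5}" "k \<in> {1..5}"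
  shows "L i j \<noteq> L i' k"
  using assms
\<comment> \<open>Swapping the columns also swaps the rows, hence \<open>i\<close> and
  \<open>i'\<close> must stay arbitrary.\<close>
proof (induction j k arbitrary: i i' rule: linorder_wlog)
  case (le k j)
  \<comment> \<open>Columns count from 1, list positions from 0.\<close>
  then have *: "nat (j - 1) = nat (k - 1) + d" "nat (j - 1) < 5" "nat (k - 1) < 5"
    by auto
  then have "row L i' ! nat (j - 1) \<noteq> row L i ! nat (k - 1)"
    using unequal_at_distanceD[of d "row L i'" "row L i" "nat (k - 1)"] le.prems(1)
    by (simp add: length_row unequal_at_distance_sym)
  with le.prems show ?case
    by (simp add: row_nth)
next
  case (sym j k)
  then show ?case
    by (metis abs_minus_commute unequal_at_distance_sym)
qed

context
  fixes L :: "int \<Rightarrow> int \<Rightarrow> int"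
  assumes L: "non_consecutive_latin_square 5 L"
begin

lemma latin: "latin_square 5 L"
  using L by (simp add: non_consecutive_latin_square_def)

lemma entry_range: "i \<in> {1..5} \<Longrightarrow> j \<in> {1..5} \<Longrightarrow> L i j \<in> {1..5}"
  using latin by (simp add: latin_square_def)

lemma row_inj:
  assumes "i \<in> {1..5}"
  shows "inj_on (L i) {1..5}"
proof (rule inj_onI)
  fix j k assume *: "j \<in> {1..5}" "k \<in> {1..5}" "L i j = L i k"
  have "\<forall>i\<in>{1..5}. \<forall>m\<in>{1..5}. \<exists>!j. j \<in> {1..5} \<and> L i j = m"
    using latin unfolding latin_square_def of_nat_numeral by (elim conjE)
  with * assms entry_range show "j = k" by blast
qed

lemma column_inj:
  assumes "j \<in> {1..5}"
  shows "inj_on (\<lambda>i. L i j) {1..5}"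
proof (rule inj_onI)
  fix i k assume *: "i \<in> {1..5}" "k \<in> {1..5}" "L i j = L k j"
  have "\<forall>j\<in>{1..5}. \<forall>m\<in>{1..5}. \<exists>!i. i \<in> {1..5} \<and> L i j = m"
    using latin unfolding latin_square_def of_nat_numeral by (elim conjE)
  with * assms entry_range show "i = k" by blast
qed

text \<open>Non-consecutiveness rules out the difference 1, and injectivity along the common row or
  column rules out 0.\<close>

lemma apart_adjacent:
  assumes "orthogonally_adjacent (i, j) (i', j')" "i \<in> {1..5}" "j \<in> {1..5}" "i' \<in> {1..5}" "j' \<in> {1..5}"
  shows "apart (L i j) (L i' j')"
proof -
  have "\<bar>L i j - L i' j'\<bar> \<noteq> 1"
    using L assms unfolding non_consecutive_latin_square_def of_nat_numeral by blast
  moreover have "L i j \<noteq> L i' j'"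
  proof
    assume eq: "L i j = L i' j'"
    from assms(1) consider "i = i'" "j \<noteq> j'" | "j = j'" "i \<noteq> i'"
      by (auto simp: orthogonally_adjacent_def)
    then show False
      using eq assms(2-) row_inj[of i] column_inj[of j] by cases (auto dest: inj_onD)
  qed
  ultimately show ?thesis
    by (simp add: apart_def)
qed

lemma row_non_consecutive:
  assumes "i \<in> {1..5}"
  shows "row L i \<in> set non_consecutive_rows"
proof -
  have "set (row L i) \<subseteq> {1..5}"
    using assms entry_range by (auto simp: row_def)
  moreover have "sorted_wrt (\<noteq>) (row L i)"
    using inj_onD[OF row_inj[OF assms]] by (fastforce simp: row_def upto_1_5)
  moreover have "successively apart (row L i)"
    using assms by (simp add: row_def upto_1_5 apart_adjacent orthogonally_adjacent_def)
  ultimately show ?thesis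
    unfolding non_consecutive_rows_def by (metis arrangements_complete length_row set_upto)
qed

lemma list_all2_apart_rows:
  assumes "i \<in> {1..4}"
  shows "list_all2 apart (row L i) (row L (i + 1))"
  using assms
  by (auto simp: row_def list.rel_map intro!: list.rel_refl_strong apart_adjacent)
     (auto simp: orthogonally_adjacent_def)

lemma rows_unequal:
  assumes "i \<in> {1..3}"
  shows "unequal_at_distance 2 (row L i) (row L (i + 1))"
    "unequal_at_distance 2 (row L (i + 1)) (row L (i + 2))"
    "unequal_at_distance 1 (row L i) (row L (i + 2))"
proof -
  \<comment> \<open>The outer rows do not touch, so only the Latin property of the columns relates
    them.\<close>
  have "list_all2 (\<noteq>) (row L i) (row L (i + 2))"
    using assms column_inj
    by (force simp: row_def list.rel_map inj_on_def intro!: list.rel_refl_strong)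
  moreover have "list_all2 apart (row L (i + 1)) (row L (i + 2))"
    using list_all2_apart_rows[of "i + 1"] assms by (simp add: add.assoc)
  ultimately show "unequal_at_distance 2 (row L i) (row L (i + 1))"
    "unequal_at_distance 2 (row L (i + 1)) (row L (i + 2))"
    "unequal_at_distance 1 (row L i) (row L (i + 2))"
    using three_rows_unequal[OF row_non_consecutive row_non_consecutive row_non_consecutive,
        of i "i + 1" "i + 2"] list_all2_apart_rows[of i] assms
    by auto
qed

text \<open>Rows 4 and 5 have no row below them, so they are taken as the lower pair of the triple
  starting at row 3.\<close>

lemma adjacent_rows_unequal:
  assumes "i \<in> {1..4}"
  shows "unequal_at_distance 2 (row L i) (row L (i + 1))"
proof (cases "i = 4")
  case True
  with rows_unequal(2)[of 3] show ?thesis by simp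
next
  case False
  with assms rows_unequal(1) show ?thesis by simp
qed

lemma knight_rows_unequal:
  assumes "\<bar>i - i'\<bar> = 1 \<and> d = 2 \<or> \<bar>i - i'\<bar> = 2 \<and> d = (1::nat)" "i \<in> {1..5}" "i' \<in> {1..5}"
  shows "unequal_at_distance d (row L i) (row L i')"
proof -
  \<comment> \<open>The cases with \<open>i\<close> below \<open>i'\<close> in the square reduce to
    the others by symmetry of \<open>unequal_at_distance\<close>.\<close>
  consider "i' = i + 1" "d = 2" | "i = i' + 1" "d = 2" | "i' = i + 2" "d = 1" | "i = i' + 2" "d = 1"
    using assms(1) by linarith
  then show ?thesis
    using assms(2,3) adjacent_rows_unequal rows_unequal(3)
    by cases (auto intro: unequal_at_distance_sym[THEN iffD1])
qed

end

theorem proposition9: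
  fixes L :: "int \<Rightarrow> int \<Rightarrow> int"
  assumes "non_consecutive_latin_square 5 L"
  shows "anti_knight_latin_square 5 L"
proof -
  have "L i j \<noteq> L i' j'"
    if "knight_move (i, j) (i', j')" "i \<in> {1..5}" "j \<in> {1..5}" "i' \<in> {1..5}" "j' \<in> {1..5}" for i j i' j'
  proof -
    have "\<bar>i - i'\<bar> = 1 \<and> \<bar>j - j'\<bar> = 2 \<or> \<bar>i - i'\<bar> = 2 \<and> \<bar>j - j'\<bar> = 1"
      using that(1) by (simp add: knight_move_def)
    \<comment> \<open>The column distance becomes the natural number \<open>d\<close> of
      \<open>knight_rows_unequal\<close>.\<close>
    then have "\<bar>i - i'\<bar> = 1 \<and> nat \<bar>j - j'\<bar> = 2 \<or> \<bar>i - i'\<bar> = 2 \<and> nat \<bar>j - j'\<bar> = 1"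
      by auto
    from knight_rows_unequal[OF assms this that(2,4)] show ?thesis
      using that by (intro unequal_at_distance_rowD) auto
  qed
  then show ?thesis
    using latin[OF assms] unfolding anti_knight_latin_square_def of_nat_numeral by blast
qed

end
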